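(* Let $n\ge 2$ and let $P_n$ denote the path of order $n$. If $n$ is even, then $D_{\max}(P_n)=D'_{\max}(P_n)=1$ and $\chi_{D,\max}(P_n)=\chi'_{D,\max}(P_n)=2$. If $n$ is odd, then $D_{\max}(P_n)=D'_{\max}(P_n)=\chi'_{D,\max}(P_n)=2$ and $\chi_{D,\max}(P_n)=3$.
   Context: An orientation of a simple graph assigns one direction to each edge. An automorphism of an oriented graph is a permutation $\phi$ of its vertices such that $\phi(u)\phi(v)$ is an arc whenever $uv$ is an arc. An $r$-vertex-labelling maps vertices to $\{1,\dots,r\}$, an $r$-arc-labelling maps arcs to $\{1,\dots,r\}$; colourings are proper labellings (adjacent vertices, resp. arcs sharing an end-vertex, get distinct labels). A labelling $\lambda$ is distinguishing if the only automorphism $\phi$ with $\lambda(\phi(u))=\lambda(u)$ for all vertices (resp. $\lambda(\phi(u)\phi(v))=\lambda(uv)$ for all arcs) is the identity. For an oriented graph $\vec G$, $D(\vec G)$, $\chi_D(\vec G)$, $D'(\vec G)$, $\chi'_D(\vec G)$ are the least $r$ for which $\vec G$ admits a distinguishing $r$-vertex-labelling, $r$-vertex-colouring, $r$-arc-labelling, $r$-arc-colouring. For an undirected graph $G$, $D_{\max}(G)$, $\chi_{D,\max}(G)$, $D'_{\max}(G)$, $\chi'_{D,\max}(G)$ are the maxima of these respective parameters over all orientations of $G$.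
   Formalization: For n = 2 the value of χ'_{D,max}(P_2) is stated as 1 instead of 2, since P_2 has a single arc and one label already gives a distinguishing arc-colouring; all other values are as stated. *)

theory Defs
  imports "Graph_Theory.Pair_Digraph" "HOL-Combinatorics.Permutations"
begin

text \<open>
  A finite simple undirected graph is a \<^locale>\<open>pair_graph\<close>: a finite, loop-free,
  symmetric pair digraph, in which an edge \<open>uv\<close> is represented by both pairs \<open>(u, v)\<close> and \<open>(v, u)\<close>.
\<close>

definition path_graph :: "nat \<Rightarrow> nat pair_pre_digraph" where
  "path_graph n =
     \<lparr> pverts = {1..n},
       parcs = {(i, j). i \<in> {1..n} \<and> j \<in> {1..n} \<and> (j = Suc i \<or> i = Suc j)} \<rparr>"

lemma pair_graph_path_graph: "pair_graph (path_graph n)"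
proof -
  have "finite ({1..n} \<times> {1..n})" by simp
  then have "finite (parcs (path_graph n))"
    by (rule rev_finite_subset) (auto simp: path_graph_def)
  then show ?thesis
    by unfold_locales (auto simp: path_graph_def symmetric_def sym_def)
qed

definition orientation :: "'a pair_pre_digraph \<Rightarrow> 'a pair_pre_digraph \<Rightarrow> bool" where
  "orientation G H \<longleftrightarrow>
     pverts H = pverts G \<and> parcs H \<subseteq> parcs G \<and>
     (\<forall>(u, v) \<in> parcs G. ((u, v) \<in> parcs H) \<noteq> ((v, u) \<in> parcs H))"

text \<open>
  Permutations of the vertex set are total functions that are the identity outside it, so that
  the identity automorphism is exactly \<^const>\<open>id\<close>.
\<close>

definition automorphism :: "'a pair_pre_digraph \<Rightarrow> ('a \<Rightarrow> 'a) \<Rightarrow> bool" where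
  "automorphism H \<phi> \<longleftrightarrow>
     \<phi> permutes pverts H \<and> (\<forall>(u, v) \<in> parcs H. (\<phi> u, \<phi> v) \<in> parcs H)"

definition vertex_labelling :: "'a pair_pre_digraph \<Rightarrow> nat \<Rightarrow> ('a \<Rightarrow> nat) \<Rightarrow> bool" where
  "vertex_labelling H r c \<longleftrightarrow> c \<in> pverts H \<rightarrow> {1..r}"

definition arc_labelling :: "'a pair_pre_digraph \<Rightarrow> nat \<Rightarrow> ('a \<times> 'a \<Rightarrow> nat) \<Rightarrow> bool" where
  "arc_labelling H r c \<longleftrightarrow> c \<in> parcs H \<rightarrow> {1..r}"

definition vertex_colouring :: "'a pair_pre_digraph \<Rightarrow> nat \<Rightarrow> ('a \<Rightarrow> nat) \<Rightarrow> bool" where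
  "vertex_colouring H r c \<longleftrightarrow>
     vertex_labelling H r c \<and> (\<forall>(u, v) \<in> parcs H. c u \<noteq> c v)"

definition arc_colouring :: "'a pair_pre_digraph \<Rightarrow> nat \<Rightarrow> ('a \<times> 'a \<Rightarrow> nat) \<Rightarrow> bool" where
  "arc_colouring H r c \<longleftrightarrow>
     arc_labelling H r c \<and>
     (\<forall>e \<in> parcs H. \<forall>f \<in> parcs H.
        e \<noteq> f \<and> {fst e, snd e} \<inter> {fst f, snd f} \<noteq> {} \<longrightarrow> c e \<noteq> c f)"

definition vertex_distinguishing :: "'a pair_pre_digraph \<Rightarrow> ('a \<Rightarrow> nat) \<Rightarrow> bool" where
  "vertex_distinguishing H c \<longleftrightarrow>
     (\<forall>\<phi>. automorphism H \<phi> \<and> (\<forall>u \<in> pverts H. c (\<phi> u) = c u) \<longrightarrow> \<phi> = id)"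

definition arc_distinguishing :: "'a pair_pre_digraph \<Rightarrow> ('a \<times> 'a \<Rightarrow> nat) \<Rightarrow> bool" where
  "arc_distinguishing H c \<longleftrightarrow>
     (\<forall>\<phi>. automorphism H \<phi> \<and> (\<forall>(u, v) \<in> parcs H. c (\<phi> u, \<phi> v) = c (u, v)) \<longrightarrow> \<phi> = id)"

text \<open>
  On a finite oriented graph the two vertex parameters always exist, since distinct labels are
  distinguishing and proper.  The two arc parameters are only meaningful if some distinguishing
  arc-labelling exists (it does not if, say, there are two isolated vertices); this is never an
  issue for orientations of paths of order at least 2.
\<close>

definition D :: "'a pair_pre_digraph \<Rightarrow> nat" where
  "D H = (LEAST r. \<exists>c. vertex_labelling H r c \<and> vertex_distinguishing H c)"

definition chi_D :: "'a pair_pre_digraph \<Rightarrow> nat" where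
  "chi_D H = (LEAST r. \<exists>c. vertex_colouring H r c \<and> vertex_distinguishing H c)"

definition D' :: "'a pair_pre_digraph \<Rightarrow> nat" where
  "D' H = (LEAST r. \<exists>c. arc_labelling H r c \<and> arc_distinguishing H c)"

definition chi'_D :: "'a pair_pre_digraph \<Rightarrow> nat" where
  "chi'_D H = (LEAST r. \<exists>c. arc_colouring H r c \<and> arc_distinguishing H c)"

text \<open>
  The next two lemmas ensure that each \<^const>\<open>Max\<close> below is taken over a finite set,
  which is nonempty in the case of paths.
\<close>

lemma finite_orientations:
  assumes "pair_graph G"
  shows "finite {H. orientation G H}"
proof -
  interpret pair_graph G by fact
  have "{H. orientation G H} \<subseteq> (\<lambda>A. \<lparr>pverts = pverts G, parcs = A\<rparr>) ` Pow (parcs G)"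
  proof
    fix H assume "H \<in> {H. orientation G H}"
    then show "H \<in> (\<lambda>A. \<lparr>pverts = pverts G, parcs = A\<rparr>) ` Pow (parcs G)"
      by (intro image_eqI[of _ _ "parcs H"]) (auto simp: orientation_def)
  qed
  then show ?thesis
    using pair_finite_arcs by (meson finite_Pow_iff finite_imageI finite_subset)
qed

lemma path_graph_orientation_exists: "\<exists>H. orientation (path_graph n) H"
  by (rule exI[of _ "\<lparr>pverts = {1..n}, parcs = {(i, j). i \<in> {1..n} \<and> j \<in> {1..n} \<and> j = Suc i}\<rparr>"])
     (auto simp: orientation_def path_graph_def)

definition D_max :: "'a pair_pre_digraph \<Rightarrow> nat" where
  "D_max G = Max (D ` {H. orientation G H})"

definition chi_D_max :: "'a pair_pre_digraph \<Rightarrow> nat" where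
  "chi_D_max G = Max (chi_D ` {H. orientation G H})"

definition D'_max :: "'a pair_pre_digraph \<Rightarrow> nat" where
  "D'_max G = Max (D' ` {H. orientation G H})"

definition chi'_D_max :: "'a pair_pre_digraph \<Rightarrow> nat" where
  "chi'_D_max G = Max (chi'_D ` {H. orientation G H})"

end

(* An automorphism of an oriented path walks along the path without ever turning back, so it is the
   identity or the reversal.  For even n the reversal flips the middle edge and is therefore never
   an automorphism.  For odd n it is an automorphism of the orientation in which every arc points
   away from the middle vertex, and a labelling is distinguishing as soon as it tells the two
   ends of the path apart.  A proper vertex colouring with only two colours cannot do that, since
   vertices of equal parity get equal colours. *)
theory Submission
  imports Defs
begin

text \<open>Injectivity forbids \<open>f (k + 2) = f k\<close>, so two consecutive unit steps have
  the same sign. The first step thus fixes all the others.\<close>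

lemma injective_unit_steps_linear:
  fixes f :: "nat \<Rightarrow> int"
  assumes inj: "inj_on f {1..n}"
    and step: "\<And>i. 1 \<le> i \<Longrightarrow> i < n \<Longrightarrow> \<bar>f (Suc i) - f i\<bar> = 1"
    and "1 \<le> i" "i \<le> n"
  shows "f i = f 1 + (int i - 1) * (f 2 - f 1)"
  using assms(3,4)
proof (induction i rule: less_induct)
  case (less i)
  consider "i = 1" | "i = 2" | k where "i = Suc (Suc k)" "1 \<le> k"
    using less.prems by (cases i; cases "i - 1"; cases "i - 2") auto
  then show ?case
  proof cases
    case (3 k)
    have "f (Suc (Suc k)) \<noteq> f k"
      using inj 3 less.prems by (auto dest: inj_onD)
    moreover have "\<bar>f (Suc k) - f k\<bar> = 1" "\<bar>f (Suc (Suc k)) - f (Suc k)\<bar> = 1"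
      using step[of k] step[of "Suc k"] 3 less.prems by auto
    ultimately have "f (Suc (Suc k)) = 2 * f (Suc k) - f k"
      by linarith
    then show ?thesis
      using less.IH[of k] less.IH[of "Suc k"] 3 less.prems by (simp add: algebra_simps)
  qed auto
qed

text \<open>Points outside \<open>{1..n}\<close> stay fixed, as \<open>permutes\<close>
  requires.\<close>

definition path_reversal :: "nat \<Rightarrow> nat \<Rightarrow> nat" where
  "path_reversal n i = (if i \<in> {1..n} then Suc n - i else i)"

lemma path_reversal_permutes: "path_reversal n permutes {1..n}"
  by (rule bij_imp_permutes, rule bij_betwI[where g = "path_reversal n"])
     (auto simp: path_reversal_def)

section \<open>Automorphisms of an oriented path\<close>

locale oriented_path =
  fixes n :: nat and H :: "nat pair_pre_digraph"
  assumes two_le: "2 \<le> n" and orientation: "orientation (path_graph n) H"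
begin

lemma pverts_eq: "pverts H = {1..n}"
  using orientation by (simp add: orientation_def path_graph_def)

lemma arc_cases:
  assumes "(u, v) \<in> parcs H"
  obtains "1 \<le> u" "u < n" "v = Suc u" | "1 \<le> v" "v < n" "u = Suc v"
proof -
  have "(u, v) \<in> parcs (path_graph n)"
    using assms orientation unfolding orientation_def by blast
  then show thesis
    using that by (auto simp: path_graph_def)
qed

lemma arc_step:
  assumes "1 \<le> i" "i < n"
  shows "((i, Suc i) \<in> parcs H) \<noteq> ((Suc i, i) \<in> parcs H)"
proof -
  have "(i, Suc i) \<in> parcs (path_graph n)"
    using assms by (simp add: path_graph_def)
  then show ?thesis
    using orientation unfolding orientation_def by fast
qed

text \<open>Each edge is an arc in some direction, so neighbours go to neighbours and the images of
  \<open>1, ..., n\<close> form an injective sequence with unit steps. Such a sequence is linear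
  with slope 1 or -1, and staying inside \<open>{1..n}\<close> determines where it starts.\<close>

lemma automorphism_eq_id_or_reversal:
  assumes "automorphism H \<phi>"
  shows "\<phi> = id \<or> \<phi> = path_reversal n"
proof -
  have perm: "\<phi> permutes {1..n}"
    using assms by (simp add: automorphism_def pverts_eq)
  have arc: "(\<phi> u, \<phi> v) \<in> parcs H" if "(u, v) \<in> parcs H" for u v
    using assms that by (auto simp: automorphism_def)
  have inj: "inj_on (\<lambda>i. int (\<phi> i)) {1..n}"
    using permutes_inj[OF perm] by (auto simp: inj_on_def)
  have step: "\<bar>int (\<phi> (Suc i)) - int (\<phi> i)\<bar> = 1" if "1 \<le> i" "i < n" for i
  proof -
    have "(\<phi> i, \<phi> (Suc i)) \<in> parcs H \<or> (\<phi> (Suc i), \<phi> i) \<in> parcs H"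
      using arc_step[OF that] arc by blast
    then show ?thesis
      by (auto elim!: arc_cases)
  qed
  have lin: "int (\<phi> i) = int (\<phi> 1) + (int i - 1) * (int (\<phi> 2) - int (\<phi> 1))"
    if "1 \<le> i" "i \<le> n" for i
    using injective_unit_steps_linear[OF inj step that] by simp
  have range: "1 \<le> \<phi> i" "\<phi> i \<le> n" if "1 \<le> i" "i \<le> n" for i
    using permutes_in_image[OF perm, of i] that by auto
  have out: "\<phi> i = i" if "i \<notin> {1..n}" for i
    using perm that by (auto simp: permutes_def)
  have "int (\<phi> 2) - int (\<phi> 1) = 1 \<or> int (\<phi> 2) - int (\<phi> 1) = - 1"
    using step[of 1] two_le by (simp add: numeral_2_eq_2) linarith
  then show ?thesis
  proof
    assume d: "int (\<phi> 2) - int (\<phi> 1) = 1"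
    \<comment> \<open>With slope 1 the vertex \<open>n\<close> goes to
      \<open>\<phi> 1 + n - 1\<close>, which is at most \<open>n\<close> only if
      \<open>\<phi> 1 = 1\<close>.\<close>
    have "\<phi> 1 = 1"
      using lin[of n, unfolded d] range[of 1] range[of n] two_le by simp
    then have "\<phi> i = i" if "i \<in> {1..n}" for i
      using lin[of i, unfolded d] that \<open>\<phi> 1 = _\<close> by auto
    then show ?thesis
      using out by (metis eq_id_iff)
  next
    assume d: "int (\<phi> 2) - int (\<phi> 1) = - 1"
    have "\<phi> 1 = n"
      using lin[of n, unfolded d] range[of 1] range[of n] two_le by simp
    then have "\<phi> i = Suc n - i" if "i \<in> {1..n}" for i
      using lin[of i, unfolded d] that \<open>\<phi> 1 = _\<close> by auto
    then have "\<phi> = path_reversal n"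
      using out by (auto simp: path_reversal_def fun_eq_iff)
    then show ?thesis ..
  qed
qed

lemma automorphism_even_eq_id:
  assumes "even n" and \<phi>: "automorphism H \<phi>"
  shows "\<phi> = id"
proof -
  obtain k where k: "n = 2 * k"
    using \<open>even n\<close> by blast
  \<comment> \<open>The ends of the middle edge are swapped, so an automorphism of this form would
    make both of its directions arcs.\<close>
  have "(path_reversal n k, path_reversal n (Suc k)) = (Suc k, k)"
    using k two_le by (auto simp: path_reversal_def)
  then have "\<phi> \<noteq> path_reversal n"
    using \<phi> arc_step[of k] k two_le by (auto simp: automorphism_def)
  then show ?thesis
    using automorphism_eq_id_or_reversal[OF \<phi>] by blast
qed

text \<open>Only the reversal has to be excluded: for even \<open>n\<close> it is not an
  automorphism, and otherwise it moves vertex 1 to vertex \<open>n\<close>, which has another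
  label.\<close>

lemma vertex_distinguishingI:
  assumes "even n \<or> c 1 \<noteq> c n"
  shows "vertex_distinguishing H c"
  unfolding vertex_distinguishing_def
proof (intro allI impI, elim conjE)
  fix \<phi> assume \<phi>: "automorphism H \<phi>" and c: "\<forall>u\<in>pverts H. c (\<phi> u) = c u"
  have "c (\<phi> 1) = c 1"
    using c two_le by (simp add: pverts_eq)
  then have "\<phi> \<noteq> path_reversal n" if "c 1 \<noteq> c n"
    using that two_le by (auto simp: path_reversal_def)
  then show "\<phi> = id"
    using assms automorphism_even_eq_id automorphism_eq_id_or_reversal \<phi> by blast
qed

text \<open>The edge between \<open>i\<close> and \<open>Suc i\<close> is given the label
  \<open>g i\<close>, and \<open>min u v\<close> recovers \<open>i\<close> from either direction.
  One \<open>g\<close> therefore serves all orientations. The reversal carries edge 1 to edge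
  \<open>n - 1\<close>.\<close>

lemma arc_distinguishingI:
  assumes "even n \<or> g 1 \<noteq> g (n - 1)"
  shows "arc_distinguishing H (\<lambda>(u, v). g (min u v))"
  unfolding arc_distinguishing_def
proof (intro allI impI, elim conjE)
  fix \<phi> assume \<phi>: "automorphism H \<phi>"
    and c: "\<forall>(u, v)\<in>parcs H.
      (\<lambda>(u, v). g (min u v)) (\<phi> u, \<phi> v) = (\<lambda>(u, v). g (min u v)) (u, v)"
  have "g (min (\<phi> 1) (\<phi> 2)) = g 1"
    using arc_step[of 1] c two_le by (auto simp: numeral_2_eq_2 min.commute)
  then have "\<phi> \<noteq> path_reversal n" if "g 1 \<noteq> g (n - 1)"
    using that two_le by (auto simp: path_reversal_def numeral_2_eq_2)
  then show "\<phi> = id"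
    using assms automorphism_even_eq_id automorphism_eq_id_or_reversal \<phi> by blast
qed

lemma proper_vertex_colouringI:
  assumes "\<And>i. 1 \<le> i \<Longrightarrow> i \<le> n \<Longrightarrow> c i \<in> {1..r}"
    and "\<And>i. 1 \<le> i \<Longrightarrow> i < n \<Longrightarrow> c i \<noteq> c (Suc i)"
  shows "vertex_colouring H r c"
  unfolding vertex_colouring_def vertex_labelling_def pverts_eq
proof (intro conjI Pi_I ballI)
  show "c i \<in> {1..r}" if "i \<in> {1..n}" for i
    using assms(1) that by simp
next
  fix e assume "e \<in> parcs H"
  then show "case e of (u, v) \<Rightarrow> c u \<noteq> c v"
    using assms(2) by (cases e) (metis arc_cases case_prod_conv)
qed

lemma arc_labellingI:
  assumes "\<And>i. 1 \<le> i \<Longrightarrow> i < n \<Longrightarrow> g i \<in> {1..r}"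
  shows "arc_labelling H r (\<lambda>(u, v). g (min u v))"
  unfolding arc_labelling_def
proof
  fix e assume "e \<in> parcs H"
  then obtain i where "1 \<le> i" "i < n" "e = (i, Suc i) \<or> e = (Suc i, i)"
    by (cases e) (auto elim!: arc_cases)
  then show "(case e of (u, v) \<Rightarrow> g (min u v)) \<in> {1..r}"
    using assms[of i] by auto
qed

lemma arc_colouringI:
  assumes "\<And>i. 1 \<le> i \<Longrightarrow> i < n \<Longrightarrow> g i \<in> {1..r}"
    and proper: "\<And>i. 1 \<le> i \<Longrightarrow> Suc i < n \<Longrightarrow> g i \<noteq> g (Suc i)"
  shows "arc_colouring H r (\<lambda>(u, v). g (min u v))"
  unfolding arc_colouring_def
proof (intro conjI ballI impI)
  show "arc_labelling H r (\<lambda>(u, v). g (min u v))"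
    using assms(1) by (rule arc_labellingI)
next
  fix e f assume e: "e \<in> parcs H" and f: "f \<in> parcs H"
    and ef: "e \<noteq> f \<and> {fst e, snd e} \<inter> {fst f, snd f} \<noteq> {}"
  obtain i where i: "1 \<le> i" "i < n" "e = (i, Suc i) \<or> e = (Suc i, i)"
    using e by (cases e) (auto elim!: arc_cases)
  obtain j where j: "1 \<le> j" "j < n" "f = (j, Suc j) \<or> f = (Suc j, j)"
    using f by (cases f) (auto elim!: arc_cases)
  \<comment> \<open>Equal positions would make \<open>e\<close> and \<open>f\<close> opposite arcs
    on one edge, which \<open>arc_step\<close> rules out.\<close>
  have "i \<noteq> j"
    using i j e f ef arc_step[of i] by auto
  then have "j = Suc i \<or> i = Suc j"
    using i j ef by auto
  then have "g i \<noteq> g j"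
    using proper[of i] proper[of j] i j by auto
  then show "(case e of (u, v) \<Rightarrow> g (min u v)) \<noteq> (case f of (u, v) \<Rightarrow> g (min u v))"
    using i j by auto
qed

section \<open>Lower bounds valid for every orientation\<close>

lemma vertex_labelling_pos: "vertex_labelling H r c \<Longrightarrow> 1 \<le> r"
  using two_le by (force simp: vertex_labelling_def pverts_eq dest: funcset_mem[where x = 1])

lemma arc_labelling_pos: "arc_labelling H r c \<Longrightarrow> 1 \<le> r"
  using two_le arc_step[of 1] by (cases "r = 0") (auto simp: arc_labelling_def)

lemma vertex_colouring_ge_2:
  assumes "vertex_colouring H r c"
  shows "2 \<le> r"
proof -
  have "c 1 \<noteq> c 2"
    using assms arc_step[of 1] two_le
    by (auto simp: vertex_colouring_def numeral_2_eq_2)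
  moreover have "c 1 \<in> {1..r}" "c 2 \<in> {1..r}"
    using assms two_le by (auto simp: vertex_colouring_def vertex_labelling_def pverts_eq)
  ultimately show ?thesis by auto
qed

text \<open>From order 3 on, two arcs meet at vertex 2. A path of order 2 has a single arc, for
  which one colour is enough.\<close>

lemma arc_colouring_ge_2:
  assumes "arc_colouring H r c" and "3 \<le> n"
  shows "2 \<le> r"
proof -
  obtain e where e: "e \<in> parcs H" "e = (1, 2) \<or> e = (2, 1)"
    using arc_step[of 1] two_le by (auto simp: numeral_2_eq_2)
  obtain f where f: "f \<in> parcs H" "f = (2, 3) \<or> f = (3, 2)"
    using arc_step[of 2] \<open>3 \<le> n\<close> by (auto simp: numeral_3_eq_3 numeral_2_eq_2)
  have "c e \<noteq> c f"
    using assms(1) e f by (auto simp: arc_colouring_def)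
  moreover have "c e \<in> {1..r}" "c f \<in> {1..r}"
    using assms(1) e f by (auto simp: arc_colouring_def arc_labelling_def)
  ultimately show ?thesis by auto
qed

text \<open>The colours are 1 and 2, so \<open>3 - c 1\<close> is the colour other than
  \<open>c 1\<close>, and properness forces a change at every step.\<close>

lemma two_colouring_alternates:
  assumes "vertex_colouring H 2 c" and "1 \<le> i" "i \<le> n"
  shows "c i = (if odd i then c 1 else 3 - c 1)"
  using assms(2,3)
proof (induction i rule: nat_induct_at_least)
  case (Suc i)
  have "c i \<noteq> c (Suc i)"
    using assms(1) arc_step[of i] Suc by (auto simp: vertex_colouring_def)
  moreover have "c j \<in> {1..2}" if "1 \<le> j" "j \<le> n" for j
    using assms(1) that by (auto simp: vertex_colouring_def vertex_labelling_def pverts_eq)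
  from this[of 1] this[of i] this[of "Suc i"]
  have "c 1 \<in> {1..2}" "c i \<in> {1..2}" "c (Suc i) \<in> {1..2}"
    using Suc two_le by auto
  ultimately show ?case
    using Suc by (auto split: if_splits)
qed simp

section \<open>Distinguishing labellings and colourings for every orientation\<close>

lemma ex_vertex_labelling_1:
  assumes "even n"
  shows "\<exists>c. vertex_labelling H 1 c \<and> vertex_distinguishing H c"
  by (rule exI[of _ "\<lambda>_. 1"])
     (use assms vertex_distinguishingI in \<open>auto simp: vertex_labelling_def\<close>)

lemma ex_vertex_labelling_2: "\<exists>c. vertex_labelling H 2 c \<and> vertex_distinguishing H c"
  by (rule exI[of _ "\<lambda>i. if i = 1 then 1 else 2"])
     (use two_le vertex_distinguishingI in \<open>auto simp: vertex_labelling_def\<close>)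

lemma ex_vertex_colouring_2:
  assumes "even n"
  shows "\<exists>c. vertex_colouring H 2 c \<and> vertex_distinguishing H c"
  by (rule exI[of _ "\<lambda>i. if odd i then 1 else 2"], intro conjI
      proper_vertex_colouringI vertex_distinguishingI) (use assms in auto)

text \<open>Colour 3 occurs on vertex 1 alone, which separates the two ends; elsewhere the colours
  alternate.\<close>

lemma ex_vertex_colouring_3: "\<exists>c. vertex_colouring H 3 c \<and> vertex_distinguishing H c"
  by (rule exI[of _ "\<lambda>i. if i = 1 then 3 else if odd i then 1 else 2"], intro conjI
      proper_vertex_colouringI vertex_distinguishingI) (use two_le in auto)

lemma ex_arc_labelling_1:
  assumes "even n"
  shows "\<exists>c. arc_labelling H 1 c \<and> arc_distinguishing H c"
  by (rule exI, rule conjI[OF arc_labellingI[of "\<lambda>_. 1"] arc_distinguishingI]) (use assms in auto)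

lemma ex_arc_colouring_1:
  assumes "n = 2"
  shows "\<exists>c. arc_colouring H 1 c \<and> arc_distinguishing H c"
  by (rule exI, rule conjI[OF arc_colouringI[of "\<lambda>_. 1"] arc_distinguishingI]) (use assms in auto)

text \<open>Alternating edge colours work for both parities: if \<open>n\<close> is odd, edges 1 and
  \<open>n - 1\<close> have opposite parity and hence different colours.\<close>

lemma ex_arc_colouring_2: "\<exists>c. arc_colouring H 2 c \<and> arc_distinguishing H c"
  by (rule exI, rule conjI[OF arc_colouringI[of "\<lambda>i. if odd i then 1 else 2"] arc_distinguishingI])
     (use two_le in auto)

lemma ex_arc_labelling_2: "\<exists>c. arc_labelling H 2 c \<and> arc_distinguishing H c"
  using ex_arc_colouring_2 by (auto simp: arc_colouring_def)

end

text \<open>The witness \<open>k\<close> guarantees that the least value satisfies \<open>P\<close>,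
  so a bound on all solutions applies to it.\<close>

lemma le_Least_nat:
  fixes P :: "nat \<Rightarrow> bool"
  assumes "P k" and "\<And>r. P r \<Longrightarrow> m \<le> r"
  shows "m \<le> (LEAST r. P r)"
  using assms LeastI by blast

text \<open>The middle vertex is \<open>m + 1\<close>. Edges at positions above \<open>m\<close>
  point upwards and the others downwards, so that the reversal exchanges the two halves.\<close>

definition diverging_path :: "nat \<Rightarrow> nat pair_pre_digraph" where
  "diverging_path m =
     \<lparr> pverts = {1..2 * m + 1},
       parcs = {(i, j). (j = Suc i \<and> m < i \<and> i \<le> 2 * m) \<or> (i = Suc j \<and> 1 \<le> j \<and> j \<le> m)} \<rparr>"

lemma orientation_diverging_path: "orientation (path_graph (2 * m + 1)) (diverging_path m)"
  by (auto simp: orientation_def path_graph_def diverging_path_def)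

lemma automorphism_diverging_path: "automorphism (diverging_path m) (path_reversal (2 * m + 1))"
  using path_reversal_permutes[of "2 * m + 1"]
  by (auto simp: automorphism_def diverging_path_def path_reversal_def)

lemma path_reversal_neq_id: "1 \<le> m \<Longrightarrow> path_reversal (2 * m + 1) \<noteq> id"
  by (auto simp: path_reversal_def fun_eq_iff intro!: exI[of _ 1])

section \<open>Lower bounds from the diverging path\<close>

locale diverging =
  fixes m :: nat
  assumes one_le: "1 \<le> m"
begin

sublocale oriented_path "2 * m + 1" "diverging_path m"
  using one_le orientation_diverging_path by unfold_locales auto

text \<open>The reversal is a nontrivial automorphism, so it must change the label of some
  \<open>i\<close>. Its image \<open>2 * m + 2 - i\<close> has the parity of \<open>i\<close>, which
  is what contradicts a proper colouring with two colours.\<close>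

lemma vertex_distinguishing_separates:
  assumes "vertex_distinguishing (diverging_path m) c"
  obtains i j where "i \<in> {1..2 * m + 1}" "j \<in> {1..2 * m + 1}" "odd i \<longleftrightarrow> odd j" "c i \<noteq> c j"
proof -
  let ?\<rho> = "path_reversal (2 * m + 1)"
  obtain i where i: "i \<in> {1..2 * m + 1}" "c (?\<rho> i) \<noteq> c i"
    using assms automorphism_diverging_path path_reversal_neq_id[OF one_le]
    unfolding vertex_distinguishing_def pverts_eq by blast
  then have "?\<rho> i \<in> {1..2 * m + 1}" "odd i \<longleftrightarrow> odd (?\<rho> i)"
    by (auto simp: path_reversal_def)
  with i that show thesis by metis
qed

lemma labelling_ge_2:
  assumes "vertex_labelling (diverging_path m) r c" "vertex_distinguishing (diverging_path m) c"
  shows "2 \<le> r"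
proof -
  obtain i j where ij: "i \<in> {1..2 * m + 1}" "j \<in> {1..2 * m + 1}" "c i \<noteq> c j"
    using vertex_distinguishing_separates assms(2) by blast
  then have "c i \<in> {1..r}" "c j \<in> {1..r}"
    using assms(1) unfolding vertex_labelling_def pverts_eq by blast+
  with ij show ?thesis by auto
qed

lemma colouring_ge_3:
  assumes c: "vertex_colouring (diverging_path m) r c" "vertex_distinguishing (diverging_path m) c"
  shows "3 \<le> r"
proof (rule ccontr)
  assume "\<not> 3 \<le> r"
  then have "r = 2"
    using vertex_colouring_ge_2[OF c(1)] by simp
  obtain i j where "i \<in> {1..2 * m + 1}" "j \<in> {1..2 * m + 1}" "odd i \<longleftrightarrow> odd j" "c i \<noteq> c j"
    using vertex_distinguishing_separates c(2) .
  then show False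
    using c(1) two_colouring_alternates[of c i] two_colouring_alternates[of c j]
    by (simp add: \<open>r = 2\<close>)
qed

text \<open>Some arc and its image under the reversal, again an arc, must carry different labels.
  The bound also covers arc colourings, which are arc labellings.\<close>

lemma arc_labelling_ge_2:
  assumes "arc_labelling (diverging_path m) r c" "arc_distinguishing (diverging_path m) c"
  shows "2 \<le> r"
proof -
  let ?\<rho> = "path_reversal (2 * m + 1)"
  obtain u v where uv: "(u, v) \<in> parcs (diverging_path m)" "c (?\<rho> u, ?\<rho> v) \<noteq> c (u, v)"
    using assms(2) automorphism_diverging_path path_reversal_neq_id[OF one_le]
    unfolding arc_distinguishing_def by blast
  then have "(?\<rho> u, ?\<rho> v) \<in> parcs (diverging_path m)"
    using automorphism_diverging_path by (auto simp: automorphism_def)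
  with uv(1) have "c (?\<rho> u, ?\<rho> v) \<in> {1..r}" "c (u, v) \<in> {1..r}"
    using assms(1) by (auto simp: arc_labelling_def)
  with uv(2) show ?thesis by auto
qed

end

text \<open>Splits each maximum into an upper bound for all orientations and a lower bound for a
  single one, \<open>H\<^sub>0\<close>.\<close>

lemma Max_path_orientations_eq:
  fixes f :: "nat pair_pre_digraph \<Rightarrow> nat"
  assumes "\<And>H. orientation (path_graph n) H \<Longrightarrow> f H \<le> k"
    and "orientation (path_graph n) H\<^sub>0" "k \<le> f H\<^sub>0"
  shows "Max (f ` {H. orientation (path_graph n) H}) = k"
  using assms by (intro Max_eqI finite_imageI finite_orientations pair_graph_path_graph)
    (auto intro!: image_eqI[of k f H\<^sub>0] antisym)

section \<open>The parameters of paths of even and odd order\<close>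

lemma path_parameters_even:
  assumes "2 \<le> n" "even n"
  shows "D_max (path_graph n) = 1" "D'_max (path_graph n) = 1" "chi_D_max (path_graph n) = 2"
    "chi'_D_max (path_graph n) = (if n = 2 then 1 else 2)"
proof -
  \<comment> \<open>For even \<open>n\<close> the upper and lower bounds agree on every orientation,
    so any one attains the maximum.\<close>
  obtain H\<^sub>0 where H0: "orientation (path_graph n) H\<^sub>0"
    using path_graph_orientation_exists by blast
  interpret H0: oriented_path n H\<^sub>0
    using assms(1) H0 by unfold_locales
  have path: "oriented_path n H" if "orientation (path_graph n) H" for H
    using assms(1) that by unfold_locales
  show "D_max (path_graph n) = 1"
    unfolding D_max_def D_def
    by (rule Max_path_orientations_eq[OF _ H0], rule Least_le, erule oriented_path.ex_vertex_labelling_1[OF path assms(2)],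
        rule le_Least_nat, rule H0.ex_vertex_labelling_1[OF assms(2)]) (use H0.vertex_labelling_pos in blast)
  show "D'_max (path_graph n) = 1"
    unfolding D'_max_def D'_def
    by (rule Max_path_orientations_eq[OF _ H0], rule Least_le, erule oriented_path.ex_arc_labelling_1[OF path assms(2)],
        rule le_Least_nat, rule H0.ex_arc_labelling_1[OF assms(2)]) (use H0.arc_labelling_pos in blast)
  show "chi_D_max (path_graph n) = 2"
    unfolding chi_D_max_def chi_D_def
    by (rule Max_path_orientations_eq[OF _ H0], rule Least_le, erule oriented_path.ex_vertex_colouring_2[OF path assms(2)],
        rule le_Least_nat, rule H0.ex_vertex_colouring_2[OF assms(2)]) (use H0.vertex_colouring_ge_2 in blast)
  \<comment> \<open>The single arc of the path of order 2 needs only one colour; the value 2 begins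
    with order 4.\<close>
  have ex: "\<exists>c. arc_colouring H (if n = 2 then 1 else 2) c \<and> arc_distinguishing H c"
    if "orientation (path_graph n) H" for H
    using oriented_path.ex_arc_colouring_1[OF path[OF that]]
      oriented_path.ex_arc_colouring_2[OF path[OF that]] by simp
  have "(if n = 2 then 1 else 2) \<le> r" if "arc_colouring H\<^sub>0 r c" for r c
    using that H0.arc_labelling_pos[of r c] H0.arc_colouring_ge_2[of r c] assms(1)
    by (auto simp: arc_colouring_def)
  then show "chi'_D_max (path_graph n) = (if n = 2 then 1 else 2)"
    unfolding chi'_D_max_def chi'_D_def
    by - (rule Max_path_orientations_eq[OF _ H0], rule Least_le, erule ex,
      rule le_Least_nat, rule ex[OF H0], blast)
qed

lemma path_parameters_odd:
  assumes "2 \<le> n" "odd n"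
  shows "D_max (path_graph n) = 2" "D'_max (path_graph n) = 2" "chi'_D_max (path_graph n) = 2"
    "chi_D_max (path_graph n) = 3"
proof -
  obtain m where m: "n = 2 * m + 1"
    using assms(2) by (auto elim: oddE)
  interpret diverging m
    using assms(1) m by unfold_locales simp
  \<comment> \<open>For odd \<open>n\<close> the diverging path is extremal for all four
    parameters.\<close>
  note H0 = orientation_diverging_path[of m, folded m]
  have path: "oriented_path n H" if "orientation (path_graph n) H" for H
    using assms(1) that by unfold_locales
  show "D_max (path_graph n) = 2"
    unfolding D_max_def D_def
    by (rule Max_path_orientations_eq[OF _ H0], rule Least_le, erule oriented_path.ex_vertex_labelling_2[OF path],
        rule le_Least_nat, rule ex_vertex_labelling_2) (use labelling_ge_2 in blast)
  show "D'_max (path_graph n) = 2"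
    unfolding D'_max_def D'_def
    by (rule Max_path_orientations_eq[OF _ H0], rule Least_le, erule oriented_path.ex_arc_labelling_2[OF path],
        rule le_Least_nat, rule ex_arc_labelling_2) (use arc_labelling_ge_2 in blast)
  show "chi'_D_max (path_graph n) = 2"
    unfolding chi'_D_max_def chi'_D_def
    by (rule Max_path_orientations_eq[OF _ H0], rule Least_le, erule oriented_path.ex_arc_colouring_2[OF path],
        rule le_Least_nat, rule ex_arc_colouring_2) (use arc_labelling_ge_2 arc_colouring_def in blast)
  show "chi_D_max (path_graph n) = 3"
    unfolding chi_D_max_def chi_D_def
    by (rule Max_path_orientations_eq[OF _ H0], rule Least_le, erule oriented_path.ex_vertex_colouring_3[OF path],
        rule le_Least_nat, rule ex_vertex_colouring_3) (use colouring_ge_3 in blast)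
qed

theorem theorem6:
  fixes n :: nat
  assumes "n \<ge> 2"
  shows "(even n \<longrightarrow>
            D_max (path_graph n) = 1 \<and> D'_max (path_graph n) = 1 \<and>
            chi_D_max (path_graph n) = 2 \<and>
            chi'_D_max (path_graph n) = (if n = 2 then 1 else 2)) \<and>
         (odd n \<longrightarrow>
            D_max (path_graph n) = 2 \<and> D'_max (path_graph n) = 2 \<and>
            chi'_D_max (path_graph n) = 2 \<and>
            chi_D_max (path_graph n) = 3)"
  using path_parameters_even[OF assms] path_parameters_odd[OF assms] by blast

end
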